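(* Let $k,a$ be positive integers and let $(G_{k,n})_{n\ge 0}$ be the Generalized $k$-Pell sequence with $G_{k,0}=G_{k,1}=a$. Then for every positive integer $m$: if $n=2m$, then \[G_{k,n+1}=\sum_{i=1}^m\sum_{j=0}^1\binom{m-2+i+j}{m-i}a^{1-j}k^{m+1-i-j}2^{2i+j-2}(ak+2a)^j,\] and if $n=2m-1$, then \[G_{k,n+1}=\sum_{i=1}^m\sum_{j=0}^1\binom{m-3+i+j}{m-i}a^{1-j}k^{m+1-i-j}2^{2i+j-3}(ak+2a)^j.\]
   Context: For positive integers $k,a$, the Generalized $k$-Pell sequence $(G_{k,n})_{n\ge 0}$ is the integer sequence defined by $G_{k,0}=G_{k,1}=a$ and $G_{k,n}=2G_{k,n-1}+kG_{k,n-2}$ for $n\ge 2$. Binomial coefficient conventions: $\binom{p}{q}=0$ for integers $0\le p<q$, and (non-standard) $\binom{-1}{0}=0$. The sums are taken in the rational numbers (the exponent of $2$ may equal $-1$). *)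

theory Defs
  imports Complex_Main
begin

fun gen_pell :: "int \<Rightarrow> int \<Rightarrow> nat \<Rightarrow> int" where
  "gen_pell k a 0 = a"
| "gen_pell k a (Suc 0) = a"
| "gen_pell k a (Suc (Suc n)) = 2 * gen_pell k a (Suc n) + k * gen_pell k a n"

text \<open>The upper argument may be \<open>-1\<close>, where the convention is that \<open>-1\<close> over \<open>0\<close> is \<open>0\<close>
  (unlike the generalised binomial coefficient \<open>gchoose\<close>, which would give \<open>1\<close>).\<close>

definition int_binom :: "int \<Rightarrow> int \<Rightarrow> nat" where
  "int_binom p q = (if 0 \<le> p \<and> 0 \<le> q then nat p choose nat q else 0)"

end

theory Submission
  imports Defs
begin

text \<open>Let \<open>U\<^sub>N\<close> be the solution of \<open>U\<^sub>N\<^sub>+\<^sub>2 = 2 U\<^sub>N\<^sub>+\<^sub>1 + k U\<^sub>N\<close> with \<open>U\<^sub>0 = 1\<close> and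
  \<open>U\<^sub>-\<^sub>1 = 0\<close>. Every solution \<open>G\<close> of that recurrence is a combination of two
  shifts of \<open>U\<close>, namely \<open>G\<^sub>N\<^sub>+\<^sub>2 = U\<^sub>N G\<^sub>2 + k U\<^sub>N\<^sub>-\<^sub>1 G\<^sub>1\<close>; for the generalized Pell sequence
  \<open>G\<^sub>2 = ak + 2a\<close> and \<open>G\<^sub>1 = a\<close> (\<open>gen_pell_eq_lucas_sum\<close>).
  On the other hand \<open>U\<^sub>N\<close> counts tilings of a strip of length \<open>N\<close> by squares of weight \<open>2\<close>
  and dominoes of weight \<open>k\<close>; sorting them by the number \<open>r\<close> of dominoes gives
  \<open>U\<^sub>N = \<Sum>\<^sub>r (N - r choose r) k\<^sup>r 2\<^sup>N\<^sup>-\<^sup>2\<^sup>r\<close>, which is the definition of \<open>lucas_sum\<close> below.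
  With \<open>r = m - i\<close>, the summands with \<open>j = 1\<close> in the theorem add up to the first of the two
  shifts and those with \<open>j = 0\<close> to the second (\<open>sum_int_binom_eq_lucas_sum\<close>).
  The convention that \<open>-1\<close> over \<open>0\<close> is \<open>0\<close> says exactly that \<open>U\<^sub>-\<^sub>1 = 0\<close>; it occurs only
  for \<open>n = 1\<close>.\<close>

text \<open>For \<open>2 * r > N\<close> the binomial coefficient vanishes, so that the truncated exponent
  \<open>N - 2 * r\<close> is harmless.\<close>

definition lucas_term :: "'a::comm_semiring_1 \<Rightarrow> 'a \<Rightarrow> nat \<Rightarrow> nat \<Rightarrow> 'a" where
  "lucas_term x y N r = of_nat (N - r choose r) * y ^ r * x ^ (N - 2 * r)"

definition lucas_sum :: "'a::comm_semiring_1 \<Rightarrow> 'a \<Rightarrow> nat \<Rightarrow> 'a" where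
  "lucas_sum x y N = (\<Sum>r\<le>N. lucas_term x y N r)"

lemma lucas_term_eq_0: "N < 2 * r \<Longrightarrow> lucas_term x y N r = 0"
  by (simp add: lucas_term_def binomial_eq_0)

lemma lucas_sum_0: "lucas_sum x y 0 = 1"
  by (simp add: lucas_sum_def lucas_term_def)

lemma lucas_sum_1: "lucas_sum x y (Suc 0) = x"
  by (simp add: lucas_sum_def lucas_term_def)

lemma lucas_sum_eq_sum_lessThan:
  assumes "N < 2 * M"
  shows "lucas_sum x y N = (\<Sum>r<M. lucas_term x y N r)"
proof -
  have "lucas_sum x y N = (\<Sum>r\<in>{r. 2 * r \<le> N}. lucas_term x y N r)"
    unfolding lucas_sum_def
    by (rule sum.mono_neutral_right) (auto simp: lucas_term_eq_0)
  also have "\<dots> = (\<Sum>r<M. lucas_term x y N r)"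
    by (rule sum.mono_neutral_left) (use assms in \<open>auto simp: lucas_term_eq_0\<close>)
  finally show ?thesis .
qed

text \<open>Pascal's rule: in a tiling with \<open>Suc r\<close> dominoes, the last tile is a square or
  a domino.\<close>

lemma lucas_term_Suc_Suc:
  "lucas_term x y (Suc (Suc N)) (Suc r) =
     x * lucas_term x y (Suc N) (Suc r) + y * lucas_term x y N r"
proof (cases "r \<le> N")
  case True
  then have "Suc N - r = Suc (N - r)" by simp
  then have pascal: "Suc N - r choose Suc r = (N - r choose Suc r) + (N - r choose r)"
    by simp
  have exponent: "of_nat (N - r choose Suc r) * x ^ (N - 2 * r) =
      of_nat (N - r choose Suc r) * (x * x ^ (Suc N - 2 * Suc r))"
  proof (cases "2 * r < N")
    case True
    then have "N - 2 * r = Suc (Suc N - 2 * Suc r)" by simp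
    then show ?thesis by simp
  next
    case False
    then have "N - r < Suc r" by simp
    then have "N - r choose Suc r = 0" by (rule binomial_eq_0)
    then show ?thesis by (simp only: of_nat_0 mult_zero_left)
  qed
  have "lucas_term x y (Suc (Suc N)) (Suc r) =
      y ^ Suc r * (of_nat (N - r choose Suc r) * x ^ (N - 2 * r)) +
      y ^ Suc r * (of_nat (N - r choose r) * x ^ (N - 2 * r))"
    using pascal by (simp add: lucas_term_def algebra_simps)
  also have "\<dots> = x * lucas_term x y (Suc N) (Suc r) + y * lucas_term x y N r"
    unfolding exponent by (simp add: lucas_term_def algebra_simps)
  finally show ?thesis .
next
  case False
  then show ?thesis by (simp add: lucas_term_eq_0)
qed

lemma lucas_sum_Suc_Suc:
  "lucas_sum x y (Suc (Suc N)) = x * lucas_sum x y (Suc N) + y * lucas_sum x y N"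
proof -
  define M where "M = Suc N"
  have first: "lucas_term x y (Suc (Suc N)) 0 = x * lucas_term x y (Suc N) 0"
    by (simp add: lucas_term_def)
  have "lucas_sum x y (Suc (Suc N)) = (\<Sum>r<Suc M. lucas_term x y (Suc (Suc N)) r)"
    by (rule lucas_sum_eq_sum_lessThan) (simp add: M_def)
  also have "\<dots> = x * (\<Sum>r<Suc M. lucas_term x y (Suc N) r) + y * (\<Sum>r<M. lucas_term x y N r)"
    unfolding sum.lessThan_Suc_shift lucas_term_Suc_Suc first
    by (simp add: sum.distrib sum_distrib_left distrib_left add.assoc)
  also have "(\<Sum>r<Suc M. lucas_term x y (Suc N) r) = lucas_sum x y (Suc N)"
    by (rule lucas_sum_eq_sum_lessThan [symmetric]) (simp add: M_def)
  also have "(\<Sum>r<M. lucas_term x y N r) = lucas_sum x y N"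
    by (rule lucas_sum_eq_sum_lessThan [symmetric]) (simp add: M_def)
  finally show ?thesis .
qed

text \<open>Both sides satisfy the same recurrence in \<open>N\<close>, so that the values at \<open>N = 0\<close> and
  \<open>N = 1\<close> decide.\<close>

lemma gen_pell_eq_lucas_sum:
  "gen_pell k a (N + 3) = (a * k + 2 * a) * lucas_sum 2 k (Suc N) + k * a * lucas_sum 2 k N"
proof (induction k a N rule: gen_pell.induct)
  case (1 k a)
  show ?case by (simp add: numeral_3_eq_3 lucas_sum_0 lucas_sum_1 algebra_simps)
next
  case (2 k a)
  show ?case
    by (simp add: numeral_eq_Suc lucas_sum_0 lucas_sum_1 lucas_sum_Suc_Suc algebra_simps)
next
  case (3 k a N)
  have "gen_pell k a (Suc (Suc N) + 3) = 2 * gen_pell k a (Suc N + 3) + k * gen_pell k a (N + 3)"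
    by (simp add: numeral_3_eq_3)
  then show ?case
    unfolding 3 by (simp add: lucas_sum_Suc_Suc algebra_simps)
qed

lemma of_int_lucas_sum:
  "of_int (lucas_sum x y N) = lucas_sum (of_int x) (of_int y) N"
  by (simp add: lucas_sum_def lucas_term_def)

lemma int_binom_of_nat: "int_binom (int p) (int q) = p choose q"
  by (simp add: int_binom_def)

text \<open>The substitution \<open>r = M - i\<close>. Under \<open>N < 2 * M\<close> every \<open>r\<close> with \<open>2 * r \<le> N\<close> is
  reached. An \<open>r\<close> with \<open>2 * r > N\<close> may be reached as well; then the exponent of \<open>x\<close> is
  negative, but the binomial coefficient is \<open>0\<close>.\<close>

lemma sum_int_binom_eq_lucas_sum:
  fixes x y :: "'a::field"
  assumes "N < 2 * M"
  shows "(\<Sum>i\<in>{1..int M}. of_nat (int_binom (int N - int M + i) (int M - i)) *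
           y powi (int M - i) * x powi (int N - 2 * int M + 2 * i)) = lucas_sum x y N"
    (is "sum ?f _ = _")
proof -
  have summand: "?f (int M - int r) = lucas_term x y N r" if "r < M" for r
  proof (cases "2 * r \<le> N")
    case True
    have "int N - int M + (int M - int r) = int (N - r)"
      "int N - 2 * int M + 2 * (int M - int r) = int (N - 2 * r)"
      "int M - (int M - int r) = int r"
      using True by auto
    then show ?thesis
      by (simp only: lucas_term_def int_binom_of_nat power_int_of_nat)
  next
    case False
    then have "nat (int N - int r) < r" using that by linarith
    then show ?thesis
      using False by (simp add: lucas_term_eq_0 int_binom_def binomial_eq_0)
  qed
  have "(\<Sum>i\<in>{1..int M}. ?f i) = (\<Sum>r<M. ?f (int M - int r))"
    by (rule sum.reindex_bij_witness [where j = "\<lambda>i. nat (int M - i)" and i = "\<lambda>r. int M - int r"])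
       auto
  also have "\<dots> = (\<Sum>r<M. lucas_term x y N r)"
    using summand by (intro sum.cong) auto
  also have "\<dots> = lucas_sum x y N"
    by (rule lucas_sum_eq_sum_lessThan [OF assms, symmetric])
  finally show ?thesis .
qed

text \<open>The arguments on the right are written so that the two inner sums are those of
  \<open>sum_int_binom_eq_lucas_sum\<close> for the lengths \<open>2 * m + 1 - c\<close> and \<open>2 * m - c\<close>. The double
  sums of the theorem are the cases \<open>c = 2\<close>, for \<open>n = 2 * m\<close>, and \<open>c = 3\<close>, for
  \<open>n = 2 * m - 1\<close>.\<close>

lemma double_sum_split:
  fixes k a :: int and m :: nat and c :: int
  assumes "k \<noteq> 0"
  shows "(\<Sum>i\<in>{1..int m}. \<Sum>j\<in>{0..1::int}.
       of_nat (int_binom (int m - c + i + j) (int m - i)) * of_int a powi (1 - j) *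
       of_int k powi (int m + 1 - i - j) * 2 powi (2 * i + j - c) *
       of_int (a * k + 2 * a) powi j) =
    rat_of_int (a * k + 2 * a) *
      (\<Sum>i\<in>{1..int m}. of_nat (int_binom (2 * int m + 1 - c - int m + i) (int m - i)) *
         of_int k powi (int m - i) * 2 powi (2 * int m + 1 - c - 2 * int m + 2 * i)) +
    rat_of_int (k * a) *
      (\<Sum>i\<in>{1..int m}. of_nat (int_binom (2 * int m - c - int m + i) (int m - i)) *
         of_int k powi (int m - i) * 2 powi (2 * int m - c - 2 * int m + 2 * i))"
proof -
  have j: "{0..1::int} = {0, 1}" by auto
  have k: "rat_of_int k powi (int m + 1 - i) = of_int k * of_int k powi (int m - i)" for i
    using power_int_add_1' [of "rat_of_int k" "int m - i"] assms by (simp add: diff_add_eq)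
  have args: "2 * int m + 1 - c - int m + i = int m - c + i + 1"
    "2 * int m - c - int m + i = int m - c + i + 0"
    "2 * int m + 1 - c - 2 * int m + 2 * i = 2 * i + 1 - c"
    "2 * int m - c - 2 * int m + 2 * i = 2 * i + 0 - c"
    "int m + 1 - i - 1 = int m - i" "int m + 1 - i - 0 = int m + 1 - i" for i
    by simp_all
  show ?thesis
    unfolding j sum_distrib_left sum.distrib [symmetric]
    by (rule sum.cong [OF refl], unfold args)
      (simp add: k mult.assoc mult.commute mult.left_commute)
qed

theorem theorem3p6:
  fixes k a :: int and m n :: nat
  assumes "k > 0" and "a > 0" and "m > 0"
  shows "(n = 2 * m \<longrightarrow>
      rat_of_int (gen_pell k a (n + 1)) =
        (\<Sum>i\<in>{1..int m}. \<Sum>j\<in>{0..1::int}.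
           of_nat (int_binom (int m - 2 + i + j) (int m - i)) * of_int a powi (1 - j) *
           of_int k powi (int m + 1 - i - j) * 2 powi (2 * i + j - 2) *
           of_int (a * k + 2 * a) powi j)) \<and>
    (n = 2 * m - 1 \<longrightarrow>
      rat_of_int (gen_pell k a (n + 1)) =
        (\<Sum>i\<in>{1..int m}. \<Sum>j\<in>{0..1::int}.
           of_nat (int_binom (int m - 3 + i + j) (int m - i)) * of_int a powi (1 - j) *
           of_int k powi (int m + 1 - i - j) * 2 powi (2 * i + j - 3) *
           of_int (a * k + 2 * a) powi j))"
proof (intro conjI impI)
  have k: "k \<noteq> 0" using assms(1) by simp
  let ?U = "lucas_sum 2 (rat_of_int k)"
  have pell: "rat_of_int (gen_pell k a (N + 3)) =
      of_int (a * k + 2 * a) * ?U (Suc N) + of_int (k * a) * ?U N" for N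
    unfolding gen_pell_eq_lucas_sum by (simp add: of_int_lucas_sum)
  {
    assume n: "n = 2 * m"
    have idx: "n + 1 = 2 * m - 2 + 3" "2 * int m + 1 - 2 = int (Suc (2 * m - 2))"
      "2 * int m - 2 = int (2 * m - 2)"
      using n assms(3) by auto
    have less: "Suc (2 * m - 2) < 2 * m" "2 * m - 2 < 2 * m"
      using assms(3) by auto
    show "rat_of_int (gen_pell k a (n + 1)) =
        (\<Sum>i\<in>{1..int m}. \<Sum>j\<in>{0..1::int}.
           of_nat (int_binom (int m - 2 + i + j) (int m - i)) * of_int a powi (1 - j) *
           of_int k powi (int m + 1 - i - j) * 2 powi (2 * i + j - 2) *
           of_int (a * k + 2 * a) powi j)"
      unfolding double_sum_split [OF k] idx sum_int_binom_eq_lucas_sum [OF less(1)]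
        sum_int_binom_eq_lucas_sum [OF less(2)] by (rule pell)
  next
    assume n: "n = 2 * m - 1"
    show "rat_of_int (gen_pell k a (n + 1)) =
        (\<Sum>i\<in>{1..int m}. \<Sum>j\<in>{0..1::int}.
           of_nat (int_binom (int m - 3 + i + j) (int m - i)) * of_int a powi (1 - j) *
           of_int k powi (int m + 1 - i - j) * 2 powi (2 * i + j - 3) *
           of_int (a * k + 2 * a) powi j)"
    proof (cases "m = 1")
      case True
      \<comment> \<open>Here the second length \<open>2 * m - 3\<close> is \<open>-1\<close>, so the convention for \<open>-1\<close> over \<open>0\<close>
        enters and the general argument does not apply.\<close>
      have j: "{0..1::int} = {0, 1}" by auto
      show ?thesis
        using True n unfolding j by (simp add: int_binom_def numeral_2_eq_2 algebra_simps)
    next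
      case False
      have idx: "n + 1 = 2 * m - 3 + 3" "2 * int m + 1 - 3 = int (Suc (2 * m - 3))"
        "2 * int m - 3 = int (2 * m - 3)"
        using n assms(3) False by auto
      have less: "Suc (2 * m - 3) < 2 * m" "2 * m - 3 < 2 * m"
        using assms(3) False by auto
      show ?thesis
        unfolding double_sum_split [OF k] idx sum_int_binom_eq_lucas_sum [OF less(1)]
          sum_int_binom_eq_lucas_sum [OF less(2)] by (rule pell)
    qed
  }
qed

end
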